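(* For any graph $G$ of order $n$ (with $n\ge 1$), \[ \operatorname{st}_{\gamma_{st}}(G)\le n-\gamma_{st}(G)+1 . \]
   Context: All graphs are finite, simple and undirected. For a graph $G=(V,E)$, a set $D\subseteq V$ is a strong dominating set if every vertex $v\in V\setminus D$ is adjacent to some $u\in D$ with $\deg(v)\le\deg(u)$ (degrees taken in $G$). The strong domination number $\gamma_{st}(G)$ is the minimum size of a strong dominating set; the graph with no vertices has $\gamma_{st}=0$. For $S\subseteq V$, $G-S$ is the graph obtained by deleting the vertices of $S$. The stability of the strong domination number is $\operatorname{st}_{\gamma_{st}}(G)=\min\{|S| : S\subseteq V,\ \gamma_{st}(G-S)\ne\gamma_{st}(G)\}$ (the choice $S=V$ is allowed, so that $\operatorname{st}_{\gamma_{st}}(K_n)=n$). *)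

theory Defs
  imports "Graph_Theory.Digraph_Component"
begin

text \<open>
  The locale \<^locale>\<open>graph\<close> of the Graph_Theory library models a finite simple undirected graph as
  a finite loop-free symmetric digraph without parallel arcs: an edge between \<open>u\<close> and \<open>v\<close> is the
  pair of opposite arcs between them. Hence \<open>v \<rightarrow>\<^bsub>G\<^esub> u\<close> is adjacency, the degree of \<open>v\<close> is the
  number of arcs leaving \<open>v\<close>, and the graph without vertices is allowed.
\<close>

abbreviation degree :: "('a, 'b) pre_digraph \<Rightarrow> 'a \<Rightarrow> nat" where
  "degree G v \<equiv> out_degree G v"

definition strong_dominating_set :: "('a, 'b) pre_digraph \<Rightarrow> 'a set \<Rightarrow> bool" where
  "strong_dominating_set G D \<longleftrightarrow>
     D \<subseteq> verts G \<and>
     (\<forall>v \<in> verts G - D. \<exists>u \<in> D. v \<rightarrow>\<^bsub>G\<^esub> u \<and> degree G v \<le> degree G u)"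

definition strong_domination_number :: "('a, 'b) pre_digraph \<Rightarrow> nat" (\<open>\<gamma>\<^sub>s\<^sub>t\<close>) where
  "\<gamma>\<^sub>s\<^sub>t G = Min {card D | D. strong_dominating_set G D}"

definition delete_verts :: "('a, 'b) pre_digraph \<Rightarrow> 'a set \<Rightarrow> ('a, 'b) pre_digraph" where
  "delete_verts G S = G \<restriction> (verts G - S)"

definition strong_domination_stability :: "('a, 'b) pre_digraph \<Rightarrow> nat" (\<open>st'_\<gamma>\<^sub>s\<^sub>t\<close>) where
  "st_\<gamma>\<^sub>s\<^sub>t G = Min {card S | S. S \<subseteq> verts G \<and> \<gamma>\<^sub>s\<^sub>t (delete_verts G S) \<noteq> \<gamma>\<^sub>s\<^sub>t G}"

text \<open>
  Both minima are taken over finite nonempty sets (the second one if \<open>G\<close> has a vertex), so that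
  \<^const>\<open>Min\<close> has its intended meaning.
\<close>

lemma strong_dominating_set_verts: "strong_dominating_set G (verts G)"
  by (simp add: strong_dominating_set_def)

lemma (in graph) finite_card_strong_dominating_sets:
  "finite {card D | D. strong_dominating_set G D}"
  by (rule finite_subset[of _ "card ` Pow (verts G)"])
     (auto simp: strong_dominating_set_def)

lemma (in graph) finite_card_changing_sets:
  "finite {card S | S. S \<subseteq> verts G \<and> \<gamma>\<^sub>s\<^sub>t (delete_verts G S) \<noteq> \<gamma>\<^sub>s\<^sub>t G}"
  by (rule finite_subset[of _ "card ` Pow (verts G)"]) auto

lemma strong_domination_number_no_verts:
  assumes "verts G = {}"
  shows "\<gamma>\<^sub>s\<^sub>t G = 0"
proof -
  have "{card D | D. strong_dominating_set G D} = {0}"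
    using assms by (auto simp: strong_dominating_set_def)
  then show ?thesis by (simp add: strong_domination_number_def)
qed

lemma (in graph) strong_domination_number_pos:
  assumes "verts G \<noteq> {}"
  shows "\<gamma>\<^sub>s\<^sub>t G > 0"
proof -
  have "\<gamma>\<^sub>s\<^sub>t G \<in> {card D | D. strong_dominating_set G D}"
    unfolding strong_domination_number_def
    using finite_card_strong_dominating_sets strong_dominating_set_verts by (intro Min_in) auto
  then obtain D where D: "\<gamma>\<^sub>s\<^sub>t G = card D" "strong_dominating_set G D" by auto
  then have "D \<noteq> {}" "finite D"
    using assms finite_subset[OF _ finite_verts] by (auto simp: strong_dominating_set_def)
  then show ?thesis using D by (simp add: card_gt_0_iff)
qed

lemma (in graph) changing_set_verts:
  assumes "verts G \<noteq> {}"
  shows "\<gamma>\<^sub>s\<^sub>t (delete_verts G (verts G)) \<noteq> \<gamma>\<^sub>s\<^sub>t G"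
  using strong_domination_number_pos[OF assms]
    strong_domination_number_no_verts[of "delete_verts G (verts G)"]
  by (simp add: delete_verts_def)

end

(* The strong domination number of a graph is at most its order. Hence deleting any
   n - \<gamma> + 1 of the n vertices, which leaves only \<gamma> - 1 vertices, changes the
   strong domination number \<gamma>. *)
theory Submission
  imports Defs
begin

text \<open>The full vertex set strongly dominates vacuously, so its size is among the candidates
  for the minimum. Assuming only finiteness lets the bound apply directly to
  \<open>delete_verts G S\<close>.\<close>

lemma strong_domination_number_le_card:
  assumes "finite (verts G)"
  shows "\<gamma>\<^sub>s\<^sub>t G \<le> card (verts G)"
proof -
  have "finite {card D | D. strong_dominating_set G D}"
    by (rule finite_subset[of _ "card ` Pow (verts G)"])
       (use assms in \<open>auto simp: strong_dominating_set_def\<close>)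
  then show ?thesis
    unfolding strong_domination_number_def
    using strong_dominating_set_verts[of G] by (intro Min_le) auto
qed

theorem theorem3p1:
  fixes G :: "('a, 'b) pre_digraph" and n :: nat
  assumes "graph G"
    and "card (verts G) = n"
    and "n \<ge> 1"
  shows "int (st_\<gamma>\<^sub>s\<^sub>t G) \<le> int n - int (\<gamma>\<^sub>s\<^sub>t G) + 1"
proof -
  interpret graph G by fact
  have "verts G \<noteq> {}" using assms(2,3) by auto
  then have pos: "\<gamma>\<^sub>s\<^sub>t G > 0" by (rule strong_domination_number_pos)
  have le: "\<gamma>\<^sub>s\<^sub>t G \<le> n"
    using strong_domination_number_le_card[of G] assms(2) by simp
  \<comment> \<open>Positivity of \<open>\<gamma>\<^sub>s\<^sub>t G\<close> absorbs the
    \<open>+ 1\<close>, so enough vertices exist to delete.\<close>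
  have "n - \<gamma>\<^sub>s\<^sub>t G + 1 \<le> card (verts G)" using pos le assms(2) by simp
  then obtain S where S: "S \<subseteq> verts G" "card S = n - \<gamma>\<^sub>s\<^sub>t G + 1"
    using obtain_subset_with_card_n by metis
  have "\<gamma>\<^sub>s\<^sub>t (delete_verts G S) \<le> card (verts G - S)"
    using strong_domination_number_le_card[of "delete_verts G S"]
    by (simp add: delete_verts_def)
  also have "\<dots> = \<gamma>\<^sub>s\<^sub>t G - 1"
    using S pos le assms(2) by (simp add: card_Diff_subset finite_subset[OF S(1)])
  \<comment> \<open>Subtraction on naturals truncates at 0, so the bound is strict only because
    \<open>\<gamma>\<^sub>s\<^sub>t G\<close> is positive.\<close>
  finally have "\<gamma>\<^sub>s\<^sub>t (delete_verts G S) \<noteq> \<gamma>\<^sub>s\<^sub>t G" using pos by linarith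
  then have "st_\<gamma>\<^sub>s\<^sub>t G \<le> card S"
    unfolding strong_domination_stability_def
    using S(1) finite_card_changing_sets by (intro Min_le) auto
  \<comment> \<open>By \<open>le\<close>, the natural difference in \<open>card S\<close> agrees
    with the integer one.\<close>
  then show ?thesis using S(2) le by simp
qed

end
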